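(* Let $s\in(0,1)$. Let $D$ be an open set in $\mathbb{R}^N$, possibly unbounded and disconnected. Suppose that $\overline D$ is disjoint from the closure of an infinite open connected cone. Let $z\in\mathcal{C}(\mathbb{R}^N)$ be bounded above and satisfy, in the viscosity sense, $$(-\Delta)^s z-c(x)z\le 0\ \text{ in }D,\qquad z\le 0\ \text{ in }\mathbb{R}^N\setminus D,$$ for some $c\in L^\infty(D)$ with $c\le 0$ a.e. in $D$ and $cz\in\mathcal{C}(D)$. Then $z\le 0$ in $D$.
   Context: For $s\in(0,1)$ the fractional Laplacian is $(-\Delta)^s u(x)=c_{N,s}\lim_{\varepsilon\to0^+}\int_{\mathbb{R}^N\setminus B_\varepsilon(x)}\frac{u(x)-u(y)}{|x-y|^{N+2s}}\,dy$, where $c_{N,s}>0$ is a normalizing constant. Viscosity sense: an upper semicontinuous function $u:\mathbb{R}^N\to\mathbb{R}$ is a viscosity sub-solution of $(-\Delta)^s u=h$ in $\tilde\Omega$, $u=g$ in $\mathbb{R}^N\setminus\tilde\Omega$ (i.e. satisfies $(-\Delta)^su\le h$ in $\tilde\Omega$, $u\le g$ outside, in the viscosity sense) if $u\le g$ a.e. in $\mathbb{R}^N\setminus\tilde\Omega$ and, whenever $x_0\in\tilde\Omega$, $U$ is a neighbourhood of $x_0$, $\phi$ is a $\mathcal{C}^2$ function in $U$ with $\phi(x_0)=u(x_0)$ and $u(x)<\phi(x)$ for every $x\in U\setminus\{x_0\}$, the function $v$ equal to $\phi$ in $U$ and to $u$ in $\mathbb{R}^N\setminus U$ satisfies $(-\Delta)^s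 v(x_0)\le h(x_0)$. Here this is applied with $\tilde\Omega=D$, $h=cz$ and $g=0$.
   Formalization: The condition z ≤ 0 in R^N \ D is required at every point, not only a.e. as in the viscosity definition; with a.e. only, the claim fails for D=(-1,1)\{0}, N=1, s>1/2, c=0 and z the Green function of (-1,1) with pole 0. *)

theory Defs
  imports "HOL-Analysis.Analysis"
begin

text \<open>
  Integral with values in the extended reals, i.e. the integral of the positive part minus that
  of the negative part. The Bochner integral is unsuitable here because it
  is \<open>0\<close> for non-integrable functions, whereas the functions fed to the fractional Laplacian
  below are only bounded on one side and their integrals may be infinite. If both parts have
  infinite integral, the value is \<open>\<infinity> - \<infinity> = \<infinity>\<close>.
\<close>

definition ext_integral :: "'a measure \<Rightarrow> ('a \<Rightarrow> real) \<Rightarrow> ereal" where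
  "ext_integral M f =
     enn2ereal (\<integral>\<^sup>+ x. ennreal (f x) \<partial>M) - enn2ereal (\<integral>\<^sup>+ x. ennreal (- f x) \<partial>M)"

text \<open>
  \<open>has_frac_laplacian \<kappa> s u x L\<close> means that the limit defining \<open>(-\<Delta>)\<^sup>s u (x)\<close> exists in
  the extended reals and equals \<open>L\<close>. The normalizing constant is the parameter \<open>\<kappa>\<close>. For \<open>u\<close>
  of class \<open>C\<^sup>2\<close> near \<open>x\<close> the limit always exists, possibly as \<open>\<plusminus>\<infinity>\<close>.
\<close>

definition frac_laplacian_trunc ::
  "real \<Rightarrow> ('a::euclidean_space \<Rightarrow> real) \<Rightarrow> 'a \<Rightarrow> real \<Rightarrow> ereal" where
  "frac_laplacian_trunc s u x \<epsilon> =
     ext_integral (lebesgue_on (UNIV - ball x \<epsilon>))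
       (\<lambda>y. (u x - u y) / norm (x - y) powr (real DIM('a) + 2 * s))"

definition has_frac_laplacian ::
  "real \<Rightarrow> real \<Rightarrow> ('a::euclidean_space \<Rightarrow> real) \<Rightarrow> 'a \<Rightarrow> ereal \<Rightarrow> bool" where
  "has_frac_laplacian \<kappa> s u x L \<longleftrightarrow>
     ((\<lambda>\<epsilon>. ereal \<kappa> * frac_laplacian_trunc s u x \<epsilon>) \<longlongrightarrow> L) (at_right 0)"

definition C2_on :: "('a::euclidean_space \<Rightarrow> real) \<Rightarrow> 'a set \<Rightarrow> bool" where
  "C2_on f U \<longleftrightarrow>
     (\<exists>(f' :: 'a \<Rightarrow> ('a \<Rightarrow>\<^sub>L real)) (f'' :: 'a \<Rightarrow> ('a \<Rightarrow>\<^sub>L ('a \<Rightarrow>\<^sub>L real))).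
        (\<forall>x\<in>U. (f has_derivative blinfun_apply (f' x)) (at x)) \<and>
        (\<forall>x\<in>U. (f' has_derivative blinfun_apply (f'' x)) (at x)) \<and>
        continuous_on U f'')"

definition upper_semicontinuous :: "('a::topological_space \<Rightarrow> real) \<Rightarrow> bool" where
  "upper_semicontinuous u \<longleftrightarrow> (\<forall>a. open {x. u x < a})"

text \<open>
  Viscosity sub-solution of \<open>(-\<Delta>)\<^sup>s u = h\<close> in \<open>\<Omega>\<close>, \<open>u = g\<close> outside \<open>\<Omega>\<close>. The test
  function \<open>\<phi>\<close> is unrestricted near the boundary of \<open>U\<close> and may be non-integrable there; the
  fractional Laplacian of the glued function is then \<open>-\<infinity>\<close> when \<open>u\<close> is integrable against
  the kernel at infinity, and the inequality holds.
\<close>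

definition viscosity_subsolution ::
  "real \<Rightarrow> real \<Rightarrow> 'a::euclidean_space set \<Rightarrow> ('a \<Rightarrow> real) \<Rightarrow> ('a \<Rightarrow> real) \<Rightarrow> ('a \<Rightarrow> real) \<Rightarrow> bool" where
  "viscosity_subsolution \<kappa> s \<Omega> h g u \<longleftrightarrow>
     upper_semicontinuous u \<and>
     (AE x in lebesgue. x \<notin> \<Omega> \<longrightarrow> u x \<le> g x) \<and>
     (\<forall>x\<^sub>0 U \<phi>. x\<^sub>0 \<in> \<Omega> \<and> open U \<and> x\<^sub>0 \<in> U \<and> C2_on \<phi> U \<and> \<phi> x\<^sub>0 = u x\<^sub>0 \<and>
        (\<forall>x\<in>U - {x\<^sub>0}. u x < \<phi> x) \<longrightarrow>
        (\<exists>L. has_frac_laplacian \<kappa> s (\<lambda>x. if x \<in> U then \<phi> x else u x) x\<^sub>0 L \<and>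
             L \<le> ereal (h x\<^sub>0)))"

text \<open>
  The predicates \<open>cone\<close> and \<open>conic\<close> of the library have vertex \<open>0\<close> and allow the factor \<open>0\<close>,
  so an open nonempty set satisfying either is the whole space. Here the vertex \<open>p\<close> is
  arbitrary and need not belong to \<open>K\<close>.
\<close>

definition infinite_open_connected_cone :: "'a::euclidean_space set \<Rightarrow> bool" where
  "infinite_open_connected_cone K \<longleftrightarrow>
     open K \<and> connected K \<and> \<not> bounded K \<and>
     (\<exists>p. \<forall>x\<in>K. \<forall>t>0. p + t *\<^sub>R (x - p) \<in> K)"

end

theory Submission
  imports Defs
begin

text \<open>
  Let \<open>M = sup z > 0\<close> and take \<open>x\<close> with \<open>z x > M - \<epsilon>\<close>. At the scale \<open>r = |x - p| + 1\<close>, where \<open>p\<close> is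
  the vertex of the cone, \<open>K\<close> occupies a fixed proportion of a ball of radius comparable to \<open>r\<close>
  around \<open>x\<close>, whatever \<open>x\<close> is. Let \<open>a\<close> maximize \<open>z y - 2\<epsilon>|y - x|\<^sup>2/r\<^sup>2\<close>; then \<open>|a - x| \<le> r\<close> and
  \<open>z a > M - \<epsilon>\<close>, and \<open>z\<close> is touched from above at \<open>a\<close> by a quadratic function with second
  derivatives of order \<open>\<epsilon>/r\<^sup>2\<close>. In the fractional Laplacian at \<open>a\<close> of the glued function, the
  quadratic part and the part far from \<open>a\<close> contribute at least \<open>- C \<epsilon> r\<^sup>-\<^sup>2\<^sup>s\<close>, the linear part
  cancels by symmetry, and the cone, where \<open>z \<le> 0\<close>, contributes at least \<open>C' M r\<^sup>-\<^sup>2\<^sup>s\<close>. For small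
  \<open>\<epsilon>\<close> the sum is positive, although \<open>c a * z a \<le> 0\<close>.
\<close>

section \<open>Integral comparison and kernel estimates on dyadic shells\<close>

text \<open>\<open>nn_integral\<close> is monotone for arbitrary functions, so \<open>f\<close> may
  be non-measurable. The negative part of \<open>f\<close> is dominated by that of \<open>G\<close>
  and has finite integral, so \<infinity> - \<infinity> cannot occur.\<close>

lemma ext_integral_ge_integral:
  assumes G: "integrable M G" and le: "\<And>x. x \<in> space M \<Longrightarrow> G x \<le> f x"
  shows "ereal (integral\<^sup>L M G) \<le> ext_integral M f"
proof -
  obtain P where P: "(\<integral>\<^sup>+ x. ennreal (G x) \<partial>M) = ennreal P" "P \<ge> 0"
    using G unfolding real_integrable_def by (metis ennreal_cases infinity_ennreal_def)
  obtain Q where Q: "(\<integral>\<^sup>+ x. ennreal (- G x) \<partial>M) = ennreal Q" "Q \<ge> 0"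
    using G unfolding real_integrable_def by (metis ennreal_cases infinity_ennreal_def)
  have I: "integral\<^sup>L M G = P - Q"
    using P Q by (simp add: real_lebesgue_integral_def[OF G])
  have "enn2ereal (ennreal P) \<le> enn2ereal (\<integral>\<^sup>+ x. ennreal (f x) \<partial>M)"
    unfolding P(1)[symmetric] less_eq_ennreal.rep_eq[symmetric]
    by (intro nn_integral_mono ennreal_leI le)
  moreover have "enn2ereal (\<integral>\<^sup>+ x. ennreal (- f x) \<partial>M) \<le> enn2ereal (ennreal Q)"
    unfolding Q(1)[symmetric] less_eq_ennreal.rep_eq[symmetric]
    by (intro nn_integral_mono ennreal_leI) (use le in auto)
  ultimately have "ereal P - ereal Q \<le> ext_integral M f"
    unfolding ext_integral_def using P(2) Q(2) by (intro ereal_minus_mono) auto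
  then show ?thesis by (simp add: I)
qed

lemma ball_in_sets_borel [measurable]: "ball x r \<in> sets borel"
  by simp

text \<open>Replaces polar coordinates: at each point of \<open>A\<close> one term of the series
  already dominates the integrand, and the series integrates term by term to ball volumes. With
  dyadic radii it becomes geometric.\<close>

lemma nn_integral_le_sum_balls:
  fixes a :: "'a::euclidean_space" and g :: "'a \<Rightarrow> real" and c R :: "nat \<Rightarrow> real"
  assumes cover: "\<And>y. y \<in> A \<Longrightarrow> \<exists>k. dist a y < R k \<and> g y \<le> c k"
    and nonneg: "\<And>k. 0 \<le> c k" "\<And>k. 0 \<le> R k"
    and S: "(\<lambda>k. c k * R k ^ DIM('a)) sums S"
  shows "(\<integral>\<^sup>+y. ennreal (indicator A y * g y) \<partial>lborel)
    \<le> ennreal (unit_ball_vol (real DIM('a)) * S)"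
proof -
  have pointwise: "ennreal (indicator A y * g y)
      \<le> (\<Sum>k. ennreal (c k) * indicator (ball a (R k)) y)" for y
  proof (cases "y \<in> A")
    case True
    then obtain k where k: "dist a y < R k" "g y \<le> c k" using cover by blast
    let ?h = "\<lambda>k. ennreal (c k) * indicator (ball a (R k)) y"
    have "ennreal (indicator A y * g y) \<le> ?h k"
      using True k by (auto intro!: ennreal_leI)
    also have "\<dots> = sum ?h {k}"
      by (simp del: sum_mult_indicator)
    also have "\<dots> \<le> suminf ?h"
      by (rule sum_le_suminf) (auto intro: summableI)
    finally show ?thesis .
  qed auto
  let ?V = "unit_ball_vol (real DIM('a))"
  have "(\<integral>\<^sup>+y. ennreal (indicator A y * g y) \<partial>lborel)
      \<le> (\<integral>\<^sup>+y. (\<Sum>k. ennreal (c k) * indicator (ball a (R k)) y) \<partial>lborel)"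
    by (intro nn_integral_mono pointwise)
  also have "\<dots> = (\<Sum>k. ennreal (c k) * emeasure lborel (ball a (R k)))"
    by (subst nn_integral_suminf) (simp_all add: nn_integral_cmult_indicator)
  also have "\<dots> = (\<Sum>k. ennreal (?V * (c k * R k ^ DIM('a))))"
    using nonneg by (intro suminf_cong)
      (simp add: emeasure_ball ennreal_mult[symmetric] algebra_simps)
  also have "\<dots> = ennreal (?V * S)"
    using sums_mult[OF S, of ?V] nonneg
    by (intro suminf_ennreal_eq) auto
  finally show ?thesis .
qed

lemma dyadic_interval_lt_1:
  fixes t :: real
  assumes "0 < t" "t < 1"
  obtains k where "1 / 2 ^ Suc k \<le> t" "t < 1 / 2 ^ k"
proof -
  let ?P = "\<lambda>n. 1 / 2 ^ n \<le> t"
  obtain n where "(1/2) ^ n < t" using real_arch_pow_inv[of t "1/2"] assms by auto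
  then have ex: "?P n" by (simp add: power_divide)
  define m where "m = (LEAST n. ?P n)"
  have m: "?P m" unfolding m_def using ex by (rule LeastI)
  then obtain k where k: "m = Suc k" using assms by (cases m) auto
  have "\<not> ?P k" using not_less_Least[of k ?P] k unfolding m_def by auto
  then show ?thesis using that m k by auto
qed

lemma dyadic_interval_ge_1:
  fixes t :: real
  assumes "1 \<le> t"
  obtains k where "2 ^ k \<le> t" "t < 2 ^ Suc k"
proof -
  let ?P = "\<lambda>n. t < 2 ^ n"
  obtain n where ex: "?P n" using real_arch_pow[of 2 t] by auto
  define m where "m = (LEAST n. ?P n)"
  have m: "?P m" unfolding m_def using ex by (rule LeastI)
  then obtain k where k: "m = Suc k" using assms by (cases m) auto
  have "\<not> ?P k" using not_less_Least[of k ?P] k unfolding m_def by auto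
  then show ?thesis using that[of k] m k by auto
qed

lemma half_powr:
  fixes x p :: real
  assumes "0 < x"
  shows "(x / 2) powr - p = x powr - p * 2 powr p"
  using assms by (simp add: powr_divide powr_minus_divide)

text \<open>On the shell r/2^(k+1) <= |y - a| < r/2^k the square is bounded at the outer radius and
  the decreasing kernel at the inner one, which costs 2^p for p = N + 2s. Scaling leaves a geometric
  series of ratio 2^(2s - 2), convergent because s < 1. The centre is excluded since it lies in no
  shell.\<close>

lemma kernel_bound_inside:
  fixes a :: "'a::euclidean_space"
  assumes s: "0 < s" "s < 1" and r: "0 < r" and A: "A \<subseteq> ball a r - {a}"
  shows "(\<integral>\<^sup>+y. ennreal (indicator A y *
      ((norm (y - a))\<^sup>2 * norm (y - a) powr - (real DIM('a) + 2 * s))) \<partial>lborel)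
    \<le> ennreal (unit_ball_vol (real DIM('a)) *
        (2 powr (real DIM('a) + 2 * s) / (1 - 2 powr (2 * s - 2)) * r powr (2 - 2 * s)))"
proof (rule nn_integral_le_sum_balls[where a = a])
  let ?p = "real DIM('a) + 2 * s"
  let ?c = "\<lambda>k. (r / 2 ^ k)\<^sup>2 * (r / 2 ^ Suc k) powr - ?p"
  let ?R = "\<lambda>k. r / 2 ^ k"
  show "0 \<le> ?c k" "0 \<le> ?R k" for k using r by auto
  show "\<exists>k. dist a y < ?R k \<and> (norm (y - a))\<^sup>2 * norm (y - a) powr - ?p \<le> ?c k"
    if "y \<in> A" for y
  proof -
    define t where "t = norm (y - a)"
    have t: "0 < t" "t < r" using that A by (auto simp: t_def dist_norm norm_minus_commute)
    obtain k where k: "1 / 2 ^ Suc k \<le> t / r" "t / r < 1 / 2 ^ k"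
      using dyadic_interval_lt_1[of "t / r"] t r by auto
    have k1: "r / 2 ^ Suc k \<le> t" using k(1) r by (simp add: field_simps)
    have k2: "t < r / 2 ^ k" using k(2) r by (simp add: field_simps)
    have "t\<^sup>2 \<le> (r / 2 ^ k)\<^sup>2" using k2 t by (intro power_mono) auto
    moreover have "t powr - ?p \<le> (r / 2 ^ Suc k) powr - ?p"
      using k1 r s by (intro powr_mono2') auto
    ultimately have "t\<^sup>2 * t powr - ?p \<le> ?c k" by (intro mult_mono) auto
    then show ?thesis using k2 by (auto simp: t_def dist_norm norm_minus_commute)
  qed
  have eq: "?c k * ?R k ^ DIM('a) =
      2 powr ?p * r powr (2 - 2 * s) * (2 powr (2 * s - 2)) ^ k" for k
  proof -
    have "?c k * ?R k ^ DIM('a) =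
        (r / 2 ^ k) powr 2 * (r / 2 ^ k / 2) powr - ?p * (r / 2 ^ k) powr real DIM('a)"
      using r by (simp add: powr_realpow field_simps)
    also have "(r / 2 ^ k / 2) powr - ?p = (r / 2 ^ k) powr - ?p * 2 powr ?p"
      using half_powr[of "r / 2 ^ k" ?p] r by simp
    also have "(r / 2 ^ k) powr 2 * ((r / 2 ^ k) powr - ?p * 2 powr ?p) * (r / 2 ^ k) powr real DIM('a)
        = 2 powr ?p * (r / 2 ^ k) powr (2 - 2 * s)"
      by (simp add: powr_add[symmetric] algebra_simps)
    also have "(r / 2 ^ k) powr (2 - 2 * s) = r powr (2 - 2 * s) * (2 powr (2 * s - 2)) ^ k"
    proof -
      have "(2 powr (2 * s - 2)) ^ k = (2 ^ k :: real) powr (2 * s - 2)"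
        by (simp add: powr_powr powr_realpow[symmetric] mult.commute)
      also have "\<dots> = (2 ^ k) powr - (2 - 2 * s)" by simp
      also have "\<dots> = 1 / (2 ^ k) powr (2 - 2 * s)" by (rule powr_minus_divide)
      finally show ?thesis using r by (simp add: powr_divide)
    qed
    finally show ?thesis by simp
  qed
  have "(2::real) powr (2 * s - 2) < 1" using s by (simp add: powr_less_one)
  then have "(\<lambda>k. (2 powr (2 * s - 2)) ^ k :: real) sums (1 / (1 - 2 powr (2 * s - 2)))"
    by (intro geometric_sums) auto
  from sums_mult[OF this, of "2 powr ?p * r powr (2 - 2 * s)"]
  show "(\<lambda>k. ?c k * ?R k ^ DIM('a)) sums
      (2 powr ?p / (1 - 2 powr (2 * s - 2)) * r powr (2 - 2 * s))"
    unfolding eq by (simp add: field_simps)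
qed

text \<open>The same count over the growing shells r 2^k <= |y - a| < r 2^(k+1). The ratio 2^(-2s)
  is below 1 because s > 0, and 2^N comes from the enclosing balls of twice the inner
  radius.\<close>

lemma kernel_bound_outside:
  fixes a :: "'a::euclidean_space"
  assumes s: "0 < s" and r: "0 < r"
  shows "(\<integral>\<^sup>+y. ennreal (indicator (- ball a r) y *
      norm (y - a) powr - (real DIM('a) + 2 * s)) \<partial>lborel)
    \<le> ennreal (unit_ball_vol (real DIM('a)) *
        (2 ^ DIM('a) / (1 - 2 powr (- 2 * s)) * r powr (- 2 * s)))"
proof (rule nn_integral_le_sum_balls[where a = a])
  let ?p = "real DIM('a) + 2 * s"
  let ?c = "\<lambda>k. (r * 2 ^ k) powr - ?p"
  let ?R = "\<lambda>k. r * 2 ^ Suc k"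
  show "0 \<le> ?c k" "0 \<le> ?R k" for k using r by auto
  show "\<exists>k. dist a y < ?R k \<and> norm (y - a) powr - ?p \<le> ?c k"
    if "y \<in> - ball a r" for y
  proof -
    define t where "t = norm (y - a)"
    have t: "r \<le> t" using that by (auto simp: t_def dist_norm norm_minus_commute)
    obtain k where k: "2 ^ k \<le> t / r" "t / r < 2 ^ Suc k"
      using dyadic_interval_ge_1[of "t / r"] t r by auto
    have k1: "r * 2 ^ k \<le> t" using k(1) r by (simp add: field_simps)
    have k2: "t < r * 2 ^ Suc k" using k(2) r by (simp add: field_simps)
    have "t powr - ?p \<le> ?c k"
      using k1 r s by (intro powr_mono2') auto
    then show ?thesis using k2 by (auto simp: t_def dist_norm norm_minus_commute)
  qed
  have eq: "?c k * ?R k ^ DIM('a) = 2 ^ DIM('a) * r powr (- 2 * s) * (2 powr (- 2 * s)) ^ k" for k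
  proof -
    have "?c k * ?R k ^ DIM('a) = 2 ^ DIM('a) * ((r * 2 ^ k) powr - ?p * (r * 2 ^ k) ^ DIM('a))"
      by (simp add: power_mult_distrib field_simps)
    also have "(r * 2 ^ k) powr - ?p * (r * 2 ^ k) ^ DIM('a) = (r * 2 ^ k) powr (- 2 * s)"
      using r by (simp add: powr_realpow[symmetric] powr_add[symmetric])
    also have "\<dots> = r powr (- 2 * s) * (2 powr (- 2 * s)) ^ k"
      using r by (simp add: powr_mult powr_powr powr_realpow[symmetric] mult.commute)
    finally show ?thesis by simp
  qed
  have "(2::real) powr (- 2 * s) < 1" using s by (simp add: powr_less_one)
  then have "(\<lambda>k. (2 powr (- 2 * s)) ^ k :: real) sums (1 / (1 - 2 powr (- 2 * s)))"
    by (intro geometric_sums) auto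
  from sums_mult[OF this, of "2 ^ DIM('a) * r powr (- 2 * s)"]
  show "(\<lambda>k. ?c k * ?R k ^ DIM('a)) sums
      (2 ^ DIM('a) / (1 - 2 powr (- 2 * s)) * r powr (- 2 * s))"
    unfolding eq by (simp add: field_simps)
qed

section \<open>Reflection, dilation and quadratic test functions\<close>

lemma integral_lborel_point_reflection:
  fixes f :: "'a::euclidean_space \<Rightarrow> real"
  assumes [measurable]: "f \<in> borel_measurable borel"
  shows "integral\<^sup>L lborel (\<lambda>y. f (2 *\<^sub>R a - y)) = integral\<^sup>L lborel f"
proof -
  have "(lborel :: 'a measure) = distr lborel borel (\<lambda>y. 2 *\<^sub>R a - y)"
    by (subst lborel_affine[of "-1" "2 *\<^sub>R a"]) (auto simp: density_1)
  then have "integral\<^sup>L lborel f = integral\<^sup>L (distr lborel borel (\<lambda>y. 2 *\<^sub>R a - y)) f"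
    by metis
  also have "\<dots> = integral\<^sup>L lborel (\<lambda>y. f (2 *\<^sub>R a - y))"
    by (rule integral_distr) auto
  finally show ?thesis by simp
qed

text \<open>Reflection through \<open>a\<close> turns the integral into its own negative.
  Non-integrable \<open>f\<close> is covered as well, by the Bochner default value 0.\<close>

lemma integral_lborel_odd:
  fixes f :: "'a::euclidean_space \<Rightarrow> real"
  assumes "f \<in> borel_measurable borel" and "\<And>y. f (2 *\<^sub>R a - y) = - f y"
  shows "integral\<^sup>L lborel f = 0"
  using integral_lborel_point_reflection[OF assms(1), of a] assms(2) by simp

text \<open>Dilations about \<open>p\<close> by \<open>r\<close> and by \<open>1 / r\<close> both
  map \<open>K\<close> into itself, so the first carries \<open>K \<inter> ball p 1\<close> exactly
  onto \<open>K \<inter> ball p r\<close>, and Lebesgue measure scales by r^N. Hence the cone has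
  the same density at every scale.\<close>

lemma emeasure_lborel_cone_ball:
  fixes K :: "'a::euclidean_space set"
  assumes K: "open K" and cone: "\<And>x t. x \<in> K \<Longrightarrow> 0 < t \<Longrightarrow> p + t *\<^sub>R (x - p) \<in> K"
    and r: "0 < r"
  shows "emeasure lborel (K \<inter> ball p r) = ennreal (r ^ DIM('a)) * emeasure lborel (K \<inter> ball p 1)"
proof -
  let ?T = "\<lambda>x. (p - r *\<^sub>R p) + r *\<^sub>R x"
  have T: "?T x = p + r *\<^sub>R (x - p)" for x by (simp add: algebra_simps)
  have "?T x \<in> K \<longleftrightarrow> x \<in> K" for x
    using cone[of "?T x" "1 / r"] cone[of x r] r by (auto simp: T)
  moreover have "dist p (?T x) = r * dist p x" for x
    using r by (simp add: T dist_norm norm_minus_commute)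
  ultimately have pre: "?T -` (K \<inter> ball p r) = K \<inter> ball p 1"
    using r by (simp add: set_eq_iff)
  have [measurable]: "K \<in> sets borel" using K by simp
  have L: "(lborel :: 'a measure) = density (distr lborel borel ?T) (\<lambda>_. ennreal (r ^ DIM('a)))"
    using lborel_affine[of r "p - r *\<^sub>R p"] r by (simp add: ennreal_power)
  have "emeasure lborel (K \<inter> ball p r) =
      emeasure (density (distr lborel borel ?T) (\<lambda>_. ennreal (r ^ DIM('a)))) (K \<inter> ball p r)"
    by (rule arg_cong[OF L])
  also have "\<dots> = ennreal (r ^ DIM('a)) * emeasure lborel (?T -` (K \<inter> ball p r))"
    using r by (simp add: emeasure_density_const emeasure_distr)
  finally show ?thesis unfolding pre .
qed

lemma open_lborel_pos:
  fixes S :: "'a::euclidean_space set"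
  assumes "open S" "S \<noteq> {}"
  shows "emeasure lborel S > 0"
proof -
  have "S \<notin> null_sets lborel"
    using open_not_negligible[OF assms] by (auto simp: negligible_iff_null_sets null_sets_completionI)
  then show ?thesis using assms(1) by (auto simp: null_sets_def zero_less_iff_neq_zero)
qed

text \<open>One square is the penalty centred at \<open>x\<close>, the other will make the contact
  at \<open>a\<close> strict. The Hessian is the constant 4q times the identity, so its continuity
  is immediate.\<close>

lemma C2_on_quadratic:
  fixes x a :: "'a::euclidean_space"
  shows "C2_on (\<lambda>y. A + q * (norm (y - x))\<^sup>2 + q * (norm (y - a))\<^sup>2) U"
proof -
  let ?f' = "\<lambda>y. blinfun_inner_right ((2 * q) *\<^sub>R (y - x) + (2 * q) *\<^sub>R (y - a))"
  have bl: "bounded_linear (\<lambda>h::'a. blinfun_inner_right ((4 * q) *\<^sub>R h))"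
    by (intro bounded_linear_compose[OF bounded_linear_blinfun_inner_right] bounded_linear_scaleR_right)
  let ?f'' = "\<lambda>y::'a. Blinfun (\<lambda>h::'a. blinfun_inner_right ((4 * q) *\<^sub>R h))"
  show ?thesis unfolding C2_on_def
  proof (intro exI conjI ballI)
    show "((\<lambda>y. A + q * (norm (y - x))\<^sup>2 + q * (norm (y - a))\<^sup>2) has_derivative
        blinfun_apply (?f' y)) (at y)" for y
      unfolding power2_norm_eq_inner
      by (auto intro!: derivative_eq_intros simp: inner_simps algebra_simps inner_commute)
    show "(?f' has_derivative blinfun_apply (?f'' y)) (at y)" for y
      unfolding bounded_linear_Blinfun_apply[OF bl]
      by (rule bounded_linear.has_derivative[OF bounded_linear_blinfun_inner_right])
        (auto intro!: derivative_eq_intros simp: scaleR_add_left[symmetric])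
    show "continuous_on U ?f''" by simp
  qed
qed

section \<open>Lower bound for the truncated fractional Laplacian\<close>

text \<open>
  The linear term in \<open>near\<close> leaves no trace in the conclusion: it is odd about \<open>a\<close>, hence integrates
  to \<open>0\<close> over the annulus.
\<close>

lemma frac_laplacian_trunc_ge:
  fixes a b :: "'a::euclidean_space" and u :: "'a \<Rightarrow> real" and s :: real
  defines "w \<equiv> real DIM('a) + 2 * s"
  assumes s: "0 < s" and r: "0 < r" and \<delta>: "0 < \<delta>" "\<delta> \<le> r"
    and nonneg: "0 \<le> q" "0 \<le> \<epsilon>" "0 \<le> m" "0 \<le> I1" "0 \<le> I2"
    and inside: "(\<integral>\<^sup>+y. ennreal (indicator (ball a r - ball a \<delta>) y *
      ((norm (y - a))\<^sup>2 * norm (y - a) powr - w)) \<partial>lborel) \<le> ennreal I1"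
    and outside: "(\<integral>\<^sup>+y. ennreal (indicator (- ball a r) y * norm (y - a) powr - w) \<partial>lborel)
      \<le> ennreal I2"
    and A: "A \<in> sets borel" "A \<inter> ball a \<delta> = {}" "A \<subseteq> cball a R" "emeasure lborel A < \<infinity>"
    and near: "\<And>y. \<delta> \<le> norm (y - a) \<Longrightarrow> norm (y - a) < r \<Longrightarrow>
      - q * (norm (y - a))\<^sup>2 - q * ((y - a) \<bullet> b) + m * indicator A y \<le> u a - u y"
    and far: "\<And>y. r \<le> norm (y - a) \<Longrightarrow> - \<epsilon> + m * indicator A y \<le> u a - u y"
  shows "ereal (m * R powr - w * measure lborel A - q * I1 - \<epsilon> * I2)
    \<le> frac_laplacian_trunc s u a \<delta>"
proof -
  let ?S = "UNIV - ball a \<delta>"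
  define k where "k = (\<lambda>y. norm (y - a) powr - w)"
  define E1 where "E1 = (\<lambda>y. indicator (ball a r - ball a \<delta>) y * ((norm (y - a))\<^sup>2 * k y))"
  define E2 where "E2 = (\<lambda>y. indicator (- ball a r) y * k y)"
  define L where "L = (\<lambda>y. indicator (ball a r - ball a \<delta>) y * (((y - a) \<bullet> b) * k y))"
  define E3 where "E3 = (\<lambda>y. indicator A y * R powr - w)"
  \<comment> \<open>\<open>G\<close> is an integrable minorant of the integrand: the bounds
    \<open>near\<close> and \<open>far\<close> times the kernel \<open>k\<close>, except that on
    \<open>A\<close> the kernel is replaced by the constant R^(-w).\<close>
  define G where "G = (\<lambda>y. m * E3 y - q * E1 y - q * L y - \<epsilon> * E2 y)"
  have w: "0 < w" unfolding w_def using s by simp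
  have k0: "0 \<le> k y" for y by (simp add: k_def)
  note [measurable] = A(1)
  have [measurable]: "k \<in> borel_measurable borel" unfolding k_def by measurable
  have [measurable]: "E1 \<in> borel_measurable borel" unfolding E1_def by measurable
  have [measurable]: "E2 \<in> borel_measurable borel" unfolding E2_def by measurable
  have [measurable]: "L \<in> borel_measurable borel" unfolding L_def by measurable
  have [measurable]: "E3 \<in> borel_measurable borel" unfolding E3_def by measurable
  have iE1: "integrable lborel E1" "integral\<^sup>L lborel E1 \<le> I1"
  proof -
    have nn: "(\<integral>\<^sup>+y. ennreal (E1 y) \<partial>lborel) \<le> ennreal I1"
      using inside by (simp add: E1_def k_def)
    have "0 \<le> E1 y" for y using k0 by (simp add: E1_def)
    with nn show "integrable lborel E1"
      by (intro integrableI_nonneg) (auto intro: le_less_trans)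
    show "integral\<^sup>L lborel E1 \<le> I1" using nn nonneg by (intro integral_real_bounded) auto
  qed
  have iE2: "integrable lborel E2" "integral\<^sup>L lborel E2 \<le> I2"
  proof -
    have nn: "(\<integral>\<^sup>+y. ennreal (E2 y) \<partial>lborel) \<le> ennreal I2"
      using outside by (simp add: E2_def k_def)
    have "0 \<le> E2 y" for y using k0 by (simp add: E2_def)
    with nn show "integrable lborel E2"
      by (intro integrableI_nonneg) (auto intro: le_less_trans)
    show "integral\<^sup>L lborel E2 \<le> I2" using nn nonneg by (intro integral_real_bounded) auto
  qed
  have iE3: "integrable lborel E3" "integral\<^sup>L lborel E3 = R powr - w * measure lborel A"
    using A unfolding E3_def by auto
  have iL: "integrable lborel L"
  proof (rule Bochner_Integration.integrable_bound)
    show "integrable lborel (\<lambda>y. norm b / \<delta> * E1 y)" using iE1 by simp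
    \<comment> \<open>Off \<open>ball a \<delta>\<close> the factor |y - a|/\<delta> is at least 1,
      so Cauchy-Schwarz bounds the linear term by |b|/\<delta> times the quadratic one. This bound
      blows up as \<delta> tends to 0, but it serves only for integrability.\<close>
    have "norm (L y) \<le> norm (norm b / \<delta> * E1 y)" for y
    proof (cases "y \<in> ball a r - ball a \<delta>")
      case True
      have "\<bar>(y - a) \<bullet> b\<bar> \<le> norm (y - a) * norm b" by (rule Cauchy_Schwarz_ineq2)
      also have "\<dots> \<le> norm (y - a) * norm b * (norm (y - a) / \<delta>)"
        using mult_left_mono[of 1 "norm (y - a) / \<delta>" "norm (y - a) * norm b"] True \<delta>
        by (simp add: dist_norm norm_minus_commute)
      finally have "\<bar>(y - a) \<bullet> b\<bar> * k y \<le> norm (y - a) * norm b * (norm (y - a) / \<delta>) * k y"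
        using k0 by (intro mult_right_mono)
      then show ?thesis using True \<delta> k0[of y]
        by (simp add: L_def E1_def abs_mult power2_eq_square field_simps)
    qed (simp add: L_def)
    then show "AE y in lborel. norm (L y) \<le> norm (norm b / \<delta> * E1 y)" by simp
  qed simp
  have L0: "integral\<^sup>L lborel L = 0"
  proof (rule integral_lborel_odd[where a = a])
    fix y
    have "2 *\<^sub>R a - y - a = - (y - a)" by (simp add: scaleR_2)
    then have refl: "k (2 *\<^sub>R a - y) = k y" "(2 *\<^sub>R a - y - a) \<bullet> b = - ((y - a) \<bullet> b)"
      "norm (2 *\<^sub>R a - y - a) = norm (y - a)"
      unfolding k_def by (simp_all only: norm_minus_cancel inner_minus_left)
    then have "2 *\<^sub>R a - y \<in> ball a t \<longleftrightarrow> y \<in> ball a t" for t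
      unfolding mem_ball dist_norm norm_minus_commute[of a] by (simp only:)
    then show "L (2 *\<^sub>R a - y) = - L y"
      unfolding L_def refl by (simp add: indicator_def)
  qed simp
  have iG: "integrable lborel G"
    unfolding G_def using iE1 iE2 iE3 iL by auto
  have IG: "integral\<^sup>L lborel G = m * (R powr - w * measure lborel A)
      - q * integral\<^sup>L lborel E1 - \<epsilon> * integral\<^sup>L lborel E2"
    unfolding G_def using iE1 iE2 iE3 iL L0 by simp
  \<comment> \<open>\<open>G\<close> vanishes on \<open>ball a \<delta>\<close>, by its disjointness
    from \<open>A\<close> and by \<delta> <= r, so restricting the domain does not change the
    integral.\<close>
  have GS: "(\<lambda>y. indicator ?S y *\<^sub>R G y) = G"
    using \<delta> A(2) unfolding G_def E1_def E2_def E3_def L_def by (auto simp: indicator_def fun_eq_iff)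
  have [measurable]: "G \<in> borel_measurable borel" unfolding G_def by measurable
  have "integrable (lebesgue_on ?S) G"
    using iG by (simp add: integrable_restrict_space GS integrable_completion del: real_scaleR_def)
  moreover have "G y \<le> (u a - u y) / norm (a - y) powr (real DIM('a) + 2 * s)"
    if "y \<in> space (lebesgue_on ?S)" for y
  proof -
    have y: "\<delta> \<le> norm (y - a)" using that by (simp add: dist_norm norm_minus_commute)
    have E3: "E3 y \<le> indicator A y * k y"
    proof (cases "y \<in> A")
      case True
      then have "norm (y - a) \<le> R" using A(3) by (auto simp: dist_norm norm_minus_commute)
      then have "R powr - w \<le> k y" unfolding k_def using y \<delta> w by (intro powr_mono2') auto
      then show ?thesis using True by (simp add: E3_def)
    qed (simp add: E3_def)
    have "G y \<le> k y * (u a - u y)"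
    proof (cases "norm (y - a) < r")
      case True
      have ind: "indicator (ball a r - ball a \<delta>) y = (1::real)" "indicator (- ball a r) y = (0::real)"
        using True y by (auto simp: dist_norm norm_minus_commute)
      have "G y \<le> m * (indicator A y * k y) - q * E1 y - q * L y - \<epsilon> * E2 y"
        unfolding G_def using E3 nonneg by (intro diff_right_mono mult_left_mono)
      also have "\<dots> = k y * (- q * (norm (y - a))\<^sup>2 - q * ((y - a) \<bullet> b) + m * indicator A y)"
        unfolding E1_def E2_def L_def ind by (simp add: algebra_simps)
      also have "\<dots> \<le> k y * (u a - u y)"
        using near[OF y True] k0 by (intro mult_left_mono)
      finally show ?thesis .
    next
      case False
      have ind: "indicator (ball a r - ball a \<delta>) y = (0::real)" "indicator (- ball a r) y = (1::real)"
        using False y by (auto simp: dist_norm norm_minus_commute)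
      have "G y \<le> m * (indicator A y * k y) - q * E1 y - q * L y - \<epsilon> * E2 y"
        unfolding G_def using E3 nonneg by (intro diff_right_mono mult_left_mono)
      also have "\<dots> = k y * (- \<epsilon> + m * indicator A y)"
        unfolding E1_def E2_def L_def ind by (simp add: algebra_simps)
      also have "\<dots> \<le> k y * (u a - u y)"
        using far[of y] False k0 by (intro mult_left_mono) auto
      finally show ?thesis .
    qed
    also have "\<dots> = (u a - u y) / norm (a - y) powr w"
      unfolding k_def by (simp add: powr_minus_divide norm_minus_commute)
    finally show ?thesis unfolding w_def .
  qed
  ultimately have "ereal (integral\<^sup>L (lebesgue_on ?S) G) \<le> frac_laplacian_trunc s u a \<delta>"
    unfolding frac_laplacian_trunc_def by (rule ext_integral_ge_integral)
  moreover have "integral\<^sup>L (lebesgue_on ?S) G = integral\<^sup>L lborel G"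
    by (simp add: integral_restrict_space GS integral_completion del: real_scaleR_def)
  moreover have "m * R powr - w * measure lborel A - q * I1 - \<epsilon> * I2 \<le> integral\<^sup>L lborel G"
    unfolding IG using iE1(2) iE2(2) nonneg
    by (smt (verit) mult.assoc mult_left_mono)
  ultimately show ?thesis by (metis ereal_less_eq(3) order_trans)
qed

section \<open>Sign of the zero-order term and the penalized maximum\<close>

text \<open>The sign of \<open>c\<close> is known only almost everywhere, so it cannot be read off
  at \<open>a\<close>. If the continuous product were positive at \<open>a\<close>, then
  \<open>c\<close> would be positive on an open neighbourhood of \<open>a\<close>, which is not
  negligible.\<close>

lemma mult_nonpos_where_pos:
  fixes c z :: "'a::euclidean_space \<Rightarrow> real"
  assumes D: "open D" and z: "continuous_on UNIV z" and cz: "continuous_on D (\<lambda>x. c x * z x)"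
    and c: "AE x in lebesgue_on D. c x \<le> 0" and a: "a \<in> D" "0 < z a"
  shows "c a * z a \<le> 0"
proof (rule ccontr)
  assume "\<not> c a * z a \<le> 0"
  define V where "V = {x \<in> D. 0 < c x * z x} \<inter> {x. 0 < z x}"
  have "open {x \<in> D. 0 < c x * z x}"
    using continuous_open_preimage[OF cz D open_greaterThan[of 0]]
    by (simp add: vimage_def Int_def)
  moreover have "open {x. 0 < z x}"
    using z by (intro open_Collect_less) auto
  ultimately have "open V" unfolding V_def by (rule open_Int)
  moreover have "a \<in> V" using \<open>\<not> c a * z a \<le> 0\<close> a by (simp add: V_def)
  ultimately have "\<not> negligible V" using open_not_negligible[of V] by auto
  moreover have "AE x in lebesgue. x \<notin> V"
  proof -
    have "AE x in lebesgue. x \<in> D \<longrightarrow> c x \<le> 0"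
      using c D by (subst (asm) AE_restrict_space_iff) auto
    then show ?thesis
      by eventually_elim (auto simp: V_def zero_less_mult_iff)
  qed
  then have "negligible V"
    by (auto simp: negligible_iff_null_sets AE_iff_null_sets \<open>open V\<close> borel_open)
  ultimately show False by simp
qed

text \<open>Since \<open>z\<close> need not attain its supremum, a penalty is subtracted. It is at
  least 2\<epsilon> outside \<open>cball x r\<close>, where the penalized function is then at most M
  - 2\<epsilon>, below its value at \<open>x\<close>; so the maximum over the compact ball is
  global.\<close>

lemma penalized_maximum:
  fixes z :: "'a::euclidean_space \<Rightarrow> real"
  assumes z: "continuous_on UNIV z" and M: "\<And>y. z y \<le> M" and x: "M - \<epsilon> < z x"
    and \<epsilon>: "0 < \<epsilon>" and r: "0 < r"
  obtains a where "norm (a - x) \<le> r"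
    "\<And>y. z y - 2 * \<epsilon> / r\<^sup>2 * (norm (y - x))\<^sup>2 \<le> z a - 2 * \<epsilon> / r\<^sup>2 * (norm (a - x))\<^sup>2"
proof -
  define g where "g = (\<lambda>y. z y - 2 * \<epsilon> / r\<^sup>2 * (norm (y - x))\<^sup>2)"
  have "continuous_on (cball x r) g"
    unfolding g_def by (intro continuous_intros continuous_on_subset[OF z]) auto
  then obtain a where a: "a \<in> cball x r" "\<And>y. y \<in> cball x r \<Longrightarrow> g y \<le> g a"
    using continuous_attains_sup[of "cball x r" g] r by auto
  have "g y \<le> g a" for y
  proof (cases "y \<in> cball x r")
    case False
    then have "r\<^sup>2 \<le> (norm (y - x))\<^sup>2"
      using r by (intro power_mono) (auto simp: dist_norm norm_minus_commute)
    then have "2 * \<epsilon> \<le> 2 * \<epsilon> / r\<^sup>2 * (norm (y - x))\<^sup>2"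
      using mult_left_mono[of "r\<^sup>2" "(norm (y - x))\<^sup>2" "2 * \<epsilon> / r\<^sup>2"] r \<epsilon> by simp
    then have "g y \<le> M - 2 * \<epsilon>" using M[of y] by (simp add: g_def)
    also have "\<dots> \<le> g x" using x \<epsilon> by (simp add: g_def)
    also have "\<dots> \<le> g a" using a(2)[of x] r by simp
    finally show ?thesis .
  qed (rule a(2))
  then show ?thesis using that[of a] a(1) by (simp add: g_def dist_norm norm_minus_commute)
qed

text \<open>Recentres the penalty from \<open>x\<close> to \<open>a\<close>, exposing a linear term
  that is odd about \<open>a\<close>.\<close>

lemma norm_diff_power2_expand:
  fixes a x y :: "'a::real_inner"
  shows "(norm (y - x))\<^sup>2 = (norm (a - x))\<^sup>2 + (norm (y - a))\<^sup>2 + 2 * ((y - a) \<bullet> (a - x))"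
  unfolding power2_norm_eq_inner by (simp add: inner_simps inner_commute)

section \<open>Contradiction at a penalized maximum\<close>

theorem theorem1p8:
  fixes \<kappa> s :: real
    and D K :: "'a::euclidean_space set"
    and z c :: "'a \<Rightarrow> real"
  assumes "0 < \<kappa>"
    and "0 < s" and "s < 1"
    and "open D"
    and "infinite_open_connected_cone K"
    and "closure D \<inter> closure K = {}"
    and "continuous_on UNIV z"
    and "bdd_above (range z)"
    and "c \<in> borel_measurable (lebesgue_on D)"
    and "\<exists>B. AE x in lebesgue_on D. \<bar>c x\<bar> \<le> B"
    and "AE x in lebesgue_on D. c x \<le> 0"
    and "continuous_on D (\<lambda>x. c x * z x)"
    and "viscosity_subsolution \<kappa> s D (\<lambda>x. c x * z x) (\<lambda>x. 0) z"
    and "\<forall>x. x \<notin> D \<longrightarrow> z x \<le> 0"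
  shows "\<forall>x\<in>D. z x \<le> 0"
proof (rule ccontr)
  assume "\<not> (\<forall>x\<in>D. z x \<le> 0)"
  then obtain x0 where x0: "0 < z x0" by (auto simp: not_le)
  define M where "M = Sup (range z)"
  have zM: "z y \<le> M" for y
    unfolding M_def using assms(8) by (intro cSup_upper) auto
  have M: "0 < M" using x0 zM[of x0] by simp
  note z = assms(7)
  have D: "x \<in> D" if "0 < z x" for x using assms(14) that by (meson not_less)

  obtain p where K: "open K" "\<not> bounded K"
    and cone: "\<And>x t. x \<in> K \<Longrightarrow> 0 < t \<Longrightarrow> p + t *\<^sub>R (x - p) \<in> K"
    using assms(5) unfolding infinite_open_connected_cone_def by auto
  have zK: "z y \<le> 0" if "y \<in> K" for y
    using that assms(6,14) closure_subset by blast

  define N where "N = real DIM('a)"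
  define w where "w = N + 2 * s"
  define \<mu> where "\<mu> = measure lborel (K \<inter> ball p 1)"
  have fin: "emeasure lborel (K \<inter> ball p \<rho>) < \<infinity>" for \<rho>
    by (rule le_less_trans[OF emeasure_mono[of _ "ball p \<rho>"]]) (use emeasure_lborel_ball_finite[of p \<rho>] in auto)
  have "\<mu> > 0"
  proof -
    obtain y where y: "y \<in> K" using K by fastforce
    \<comment> \<open>Shrinks \<open>y\<close> toward the vertex until it lies in
      \<open>ball p 1\<close>; the cone property keeps it in \<open>K\<close>.\<close>
    define t where "t = 1 / (1 + norm (y - p))"
    have t: "0 < t" "t * norm (y - p) < 1" by (auto simp: t_def field_simps add_pos_nonneg)
    then have "p + t *\<^sub>R (y - p) \<in> K \<inter> ball p 1"
      using cone[OF y t(1)] by (auto simp: dist_norm)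
    then have "0 < emeasure lborel (K \<inter> ball p 1)"
      using K by (intro open_lborel_pos) auto
    then show ?thesis unfolding \<mu>_def using fin[of 1]
      by (simp add: measure_def enn2real_positive_iff)
  qed
  have \<mu>r: "measure lborel (K \<inter> ball p r) = r powr N * \<mu>" if "0 < r" for r
    using emeasure_lborel_cone_ball[OF K(1) cone that] that
    unfolding measure_def \<mu>_def N_def by (simp add: enn2real_mult powr_realpow)

  let ?V = "unit_ball_vol N"
  define C1 where "C1 = ?V * (2 powr w / (1 - 2 powr (2 * s - 2)))"
  define C2 where "C2 = ?V * (2 ^ DIM('a) / (1 - 2 powr (- 2 * s)))"
  have "(2::real) powr (2 * s - 2) < 1" "(2::real) powr (- 2 * s) < 1"
    using assms by (simp_all add: powr_less_one)
  then have C: "0 \<le> C1" "0 \<le> C2" unfolding C1_def C2_def N_def by simp_all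

  \<comment> \<open>On the cone z <= 0, so z a - z y > M - \<epsilon> there. The penalty costs at
    most a further 2\<epsilon>, and 3\<epsilon> <= M/2 leaves at least \<open>m\<close>.\<close>
  define m where "m = M / 2"
  \<comment> \<open>The piece \<open>K \<inter> ball p r\<close> will lie in
    \<open>cball a (3 * r)\<close> and has measure r^N \<mu>, so its kernel mass is at least
    (3r)^(-w) r^N \<mu> = B r^(-2s).\<close>
  define B where "B = 3 powr - w * \<mu>"
  have "0 < B" using \<open>\<mu> > 0\<close> by (simp add: B_def)
  \<comment> \<open>In units of r^(-2s) the total error will be \<epsilon> (4 C1 + C2); the second
    bound keeps it below m B, and the summand 1 keeps the denominator positive. The choice precedes
    \<open>x\<close> and \<open>r\<close>, which depend on it.\<close>
  define \<epsilon> where "\<epsilon> = min (M / 6) (m * B / (2 * (4 * C1 + C2 + 1)))"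
  have \<epsilon>: "0 < \<epsilon>" "3 * \<epsilon> \<le> m"
    using M \<open>0 < B\<close> C by (auto simp: \<epsilon>_def m_def intro!: divide_pos_pos add_nonneg_pos)
  have "\<epsilon> * (4 * C1 + C2 + 1) \<le> m * B / (2 * (4 * C1 + C2 + 1)) * (4 * C1 + C2 + 1)"
    unfolding \<epsilon>_def using C by (intro mult_right_mono) auto
  also have "\<dots> = m * B / 2" using C by (simp add: field_simps)
  also have "\<dots> < m * B" using M \<open>0 < B\<close> by (simp add: m_def)
  finally have gap: "0 < m * B - 4 * \<epsilon> * C1 - \<epsilon> * C2" using \<epsilon> by (simp add: algebra_simps)

  obtain x where x: "M - \<epsilon> < z x"
    using less_cSupD[of "range z" "M - \<epsilon>"] \<epsilon>(1) by (auto simp: M_def)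
  \<comment> \<open>Adding 1 keeps the scale positive when x = p.\<close>
  define r where "r = norm (x - p) + 1"
  have r: "0 < r" by (simp add: r_def add_nonneg_pos)
  define q where "q = 2 * \<epsilon> / r\<^sup>2"
  have q: "0 < q" "q * r\<^sup>2 = 2 * \<epsilon>" using \<epsilon> r by (auto simp: q_def)
  obtain a where a: "norm (a - x) \<le> r"
    and amax: "\<And>y. z y - q * (norm (y - x))\<^sup>2 \<le> z a - q * (norm (a - x))\<^sup>2"
    using penalized_maximum[OF z zM x \<epsilon>(1) r] unfolding q_def by metis
  have za: "M - \<epsilon> < z a"
  proof -
    have "z x \<le> z a - q * (norm (a - x))\<^sup>2" using amax[of x] by simp
    moreover have "0 \<le> q * (norm (a - x))\<^sup>2" using q by simp
    ultimately show ?thesis using x by linarith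
  qed
  have za0: "0 < z a" using za \<epsilon> M by (simp add: m_def)

  have "open {y. 0 < z y}" using z by (intro open_Collect_less) auto
  then obtain \<rho>0 where \<rho>0: "0 < \<rho>0" "ball a \<rho>0 \<subseteq> {y. 0 < z y}"
    using za0 open_contains_ball[of "{y. 0 < z y}"] by auto
  \<comment> \<open>Positivity of \<open>z\<close> on the ball keeps it off \<open>K\<close>, so
    gluing leaves \<open>z\<close> unchanged on the cone; \<rho> <= r keeps the gluing out of the
    far region.\<close>
  define \<rho> where "\<rho> = min \<rho>0 r"
  have \<rho>: "0 < \<rho>" "\<rho> \<le> r" "ball a \<rho> \<inter> K = {}"
    using \<rho>0 r zK by (auto simp: \<rho>_def subset_iff) (meson not_less)
  \<comment> \<open>By maximality at \<open>a\<close> the constant and the first square together lie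
    above \<open>z\<close>, with equality at \<open>a\<close>; the last square makes the contact
    strict.\<close>
  define \<phi> where "\<phi> = (\<lambda>y. (z a - q * (norm (a - x))\<^sup>2) + q * (norm (y - x))\<^sup>2 + q * (norm (y - a))\<^sup>2)"
  define v where "v = (\<lambda>y. if y \<in> ball a \<rho> then \<phi> y else z y)"
  have above: "z y < \<phi> y" if "y \<noteq> a" for y
  proof -
    have "0 < q * (norm (y - a))\<^sup>2" using q that by simp
    then show ?thesis using amax[of y] by (simp add: \<phi>_def)
  qed
  have \<phi>a: "\<phi> a = z a" by (simp add: \<phi>_def)
  have C2: "C2_on \<phi> (ball a \<rho>)" unfolding \<phi>_def by (rule C2_on_quadratic)
  have "\<exists>l. has_frac_laplacian \<kappa> s v a l \<and> l \<le> ereal (c a * z a)"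
    unfolding v_def
  proof (rule assms(13)[unfolded viscosity_subsolution_def, THEN conjunct2, THEN conjunct2,
        rule_format, of a "ball a \<rho>" \<phi>], intro conjI ballI)
    show "a \<in> D" "a \<in> ball a \<rho>" using D[OF za0] \<rho>(1) by auto
  qed (use above \<phi>a C2 in auto)
  then obtain l where l: "has_frac_laplacian \<kappa> s v a l" "l \<le> ereal (c a * z a)" by blast
  have "c a * z a \<le> 0"
    using mult_nonpos_where_pos[OF assms(4) z assms(12,11) D[OF za0] za0] .
  then have l0: "l \<le> 0" using order_trans[OF l(2), of 0] by simp

  have va: "v a = z a" using \<rho> \<phi>a by (simp add: v_def)
  have zinc: "q * (norm (y - x))\<^sup>2 = q * (norm (a - x))\<^sup>2 + q * (norm (y - a))\<^sup>2 + 2 * q * ((y - a) \<bullet> (a - x))" for y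
    unfolding norm_diff_power2_expand[of y x a] by (simp add: algebra_simps)
  \<comment> \<open>\<eta> does not depend on the truncation radius, so the bound survives the limit
    \<delta> -> 0.\<close>
  define \<eta> where "\<eta> = r powr (- 2 * s) * (m * B - 4 * \<epsilon> * C1 - \<epsilon> * C2)"
  have "0 < \<eta>" unfolding \<eta>_def using gap r by simp
  have trunc: "ereal \<eta> \<le> frac_laplacian_trunc s v a \<delta>" if \<delta>: "0 < \<delta>" "\<delta> < \<rho>" for \<delta>
  proof -
    let ?A = "K \<inter> ball p r"
    have AK: "y \<in> K" "y \<notin> ball a \<rho>" if "y \<in> ?A" for y using that \<rho> by auto
    have "ereal (m * (3 * r) powr - (real DIM('a) + 2 * s) * measure lborel ?A
        - (2 * q) * (C1 * r powr (2 - 2 * s)) - \<epsilon> * (C2 * r powr (- 2 * s)))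
      \<le> frac_laplacian_trunc s v a \<delta>"
    \<comment> \<open>Expanding \<open>\<phi>\<close> about \<open>a\<close> gives the gradient 2q(a
      - x) and the quadratic part 2q|y - a|^2: hence the coefficient \<open>2 * q\<close> and the
      direction \<open>a - x\<close>, with equality in the near bound inside
      \<open>ball a \<rho>\<close>.\<close>
    proof (rule frac_laplacian_trunc_ge[where b = "a - x"])
      show "(\<integral>\<^sup>+y. ennreal (indicator (ball a r - ball a \<delta>) y *
          ((norm (y - a))\<^sup>2 * norm (y - a) powr - (real DIM('a) + 2 * s))) \<partial>lborel)
        \<le> ennreal (C1 * r powr (2 - 2 * s))"
        unfolding C1_def w_def N_def mult.assoc[of "unit_ball_vol _"]
        by (rule kernel_bound_inside[OF assms(2,3) r]) (use \<delta> in auto)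
      show "(\<integral>\<^sup>+y. ennreal (indicator (- ball a r) y * norm (y - a) powr - (real DIM('a) + 2 * s)) \<partial>lborel)
        \<le> ennreal (C2 * r powr (- 2 * s))"
        unfolding C2_def N_def mult.assoc[of "unit_ball_vol _"]
        by (rule kernel_bound_outside[OF assms(2) r])
      show "?A \<in> sets borel" using K by auto
      show "?A \<inter> ball a \<delta> = {}" using \<rho>(3) subset_ball[of \<delta> \<rho> a] \<delta> by auto
      show "?A \<subseteq> cball a (3 * r)"
      proof
        fix y assume "y \<in> ?A"
        then have "norm (y - p) < r" by (simp add: dist_norm norm_minus_commute)
        moreover have "norm (y - a) \<le> norm (y - p) + norm (x - p) + norm (a - x)"
          using norm_triangle_ineq4[of "y - p" "x - p"] norm_triangle_ineq4[of "y - x" "a - x"]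
          by simp
        ultimately show "y \<in> cball a (3 * r)"
          using a by (simp add: dist_norm norm_minus_commute r_def)
      qed
      show "emeasure lborel ?A < \<infinity>" by (rule fin)
      show "- (2 * q) * (norm (y - a))\<^sup>2 - 2 * q * ((y - a) \<bullet> (a - x)) + m * indicator ?A y \<le> v a - v y"
        if "\<delta> \<le> norm (y - a)" "norm (y - a) < r" for y
      proof (cases "y \<in> ball a \<rho>")
        case True
        then have "indicator ?A y = (0::real)" using AK(2) by (auto simp: indicator_def)
        then show ?thesis using True zinc[of y] unfolding va by (simp add: v_def \<phi>_def)
      next
        case False
        have nonneg: "0 \<le> q * (norm (y - a))\<^sup>2" "0 \<le> q * (norm (y - x))\<^sup>2" using q by auto
        have v: "v y = z y" using False by (simp add: v_def)
        have "q * (norm (a - x))\<^sup>2 \<le> q * r\<^sup>2"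
          using a q by (intro mult_left_mono power_mono) auto
        then have ax: "q * (norm (a - x))\<^sup>2 \<le> 2 * \<epsilon>" using q by simp
        show ?thesis
        proof (cases "y \<in> ?A")
          case True
          then show ?thesis
            using zK[OF AK(1)[OF True]] za \<epsilon> ax nonneg zinc[of y] unfolding va v by (simp add: m_def)
        next
          case False
          \<comment> \<open>Off the gluing ball and off \<open>?A\<close>, maximality of the
            penalized function gives the bound, even with q in place of 2q in the quadratic
            term.\<close>
          then show ?thesis using amax[of y] zinc[of y] nonneg unfolding va v by simp
        qed
      qed
      show "- \<epsilon> + m * indicator ?A y \<le> v a - v y" if "r \<le> norm (y - a)" for y
      proof -
        have "y \<notin> ball a \<rho>" using that \<rho> by (auto simp: dist_norm norm_minus_commute)
        then have v: "v y = z y" by (simp add: v_def)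
        show ?thesis
          using za zM[of y] zK[of y] \<epsilon> M unfolding va v by (auto simp: indicator_def m_def)
      qed
    qed (use assms r \<delta> \<rho> q \<epsilon> C M in \<open>auto simp: m_def\<close>)
    also have "m * (3 * r) powr - (real DIM('a) + 2 * s) * measure lborel ?A
        - (2 * q) * (C1 * r powr (2 - 2 * s)) - \<epsilon> * (C2 * r powr (- 2 * s)) = \<eta>"
    proof -
      have rw: "r powr - w * r powr N = r powr (- 2 * s)"
        unfolding powr_add[symmetric] by (simp add: w_def)
      have "(3 * r) powr - w * measure lborel ?A = B * (r powr - w * r powr N)"
        unfolding \<mu>r[OF r] B_def using r by (simp add: powr_mult)
      then have 1: "(3 * r) powr - w * measure lborel ?A = B * r powr (- 2 * s)"
        unfolding rw .
      have "r powr (2 - 2 * s) = r powr 2 * r powr (- 2 * s)"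
        unfolding powr_add[symmetric] by simp
      then have "r powr (2 - 2 * s) = r\<^sup>2 * r powr (- 2 * s)"
        using r by simp
      \<comment> \<open>The relation q r^2 = 2\<epsilon> brings the quadratic error to the common
        scale r^(-2s); with the factor \<open>2 * q\<close> it yields the 4 \<epsilon> C1 of
        \<open>gap\<close>.\<close>
      then have 2: "q * r powr (2 - 2 * s) = 2 * \<epsilon> * r powr (- 2 * s)"
        using q(2) by (metis mult.assoc)
      have "m * (3 * r) powr - w * measure lborel ?A
          - (2 * q) * (C1 * r powr (2 - 2 * s)) - \<epsilon> * (C2 * r powr (- 2 * s))
        = m * ((3 * r) powr - w * measure lborel ?A)
          - 2 * C1 * (q * r powr (2 - 2 * s)) - \<epsilon> * (C2 * r powr (- 2 * s))"
        by simp
      also have "\<dots> = \<eta>" unfolding 1 2 \<eta>_def by (simp add: algebra_simps)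
      finally show ?thesis unfolding w_def N_def .
    qed
    finally show ?thesis .
  qed
  have "ereal (\<kappa> * \<eta>) \<le> l"
  proof (rule tendsto_lowerbound)
    show "((\<lambda>\<delta>. ereal \<kappa> * frac_laplacian_trunc s v a \<delta>) \<longlongrightarrow> l) (at_right 0)"
      using l(1) unfolding has_frac_laplacian_def .
    show "eventually (\<lambda>\<delta>. ereal (\<kappa> * \<eta>) \<le> ereal \<kappa> * frac_laplacian_trunc s v a \<delta>) (at_right 0)"
      using eventually_at_right_real[OF \<rho>(1)]
    proof eventually_elim
      case (elim \<delta>)
      then have "ereal \<eta> \<le> frac_laplacian_trunc s v a \<delta>" using trunc by simp
      then show ?case
        using ereal_mult_left_mono[of "ereal \<eta>" _ "ereal \<kappa>"] assms(1) by simp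
    qed
  qed simp
  moreover have "0 < \<kappa> * \<eta>" using assms(1) \<open>0 < \<eta>\<close> by simp
  ultimately show False using order_trans[of "ereal (\<kappa> * \<eta>)" l 0] l0 by simp
qed

end
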